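(* Let $\mathbb{Q}$ be the set of all rational numbers in $\mathbb{R}$ (with the subspace topology). There exists a Baire-one function $f:\mathbb{Q}\to\mathbb{Q}$ which does not belong to $\mathrm{hB}_1(\mathbb{Q},\mathbb{Q})$.
   Context: For topological spaces $X$ and $Y$: a map $f:X\to Y$ (not necessarily continuous) is a Baire-one map (function) if there is a sequence $(f_n)_{n\in\omega}$ of continuous maps $f_n:X\to Y$ with $\lim_{n\to\infty} f_n(x)=f(x)$ for every $x\in X$. A map $f:X\to Y$ is a homotopical Baire-one map if there is a sequence $(f_n)_{n\in\omega}$ of pairwise homotopic continuous maps $f_n:X\to Y$ with $\lim_{n\to\infty} f_n(x)=f(x)$ for every $x\in X$; equivalently, there is a continuous map $H:X\times[0,+\infty)\to Y$ such that $\lim_{n\to\infty}H(x,n)=f(x)$ for every $x\in X$. $\mathrm{hB}_1(X,Y)$ denotes the set of all homotopical Baire-one maps $X\to Y$. *)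

theory Defs
  imports "HOL-Analysis.Analysis"
begin

definition baire_one_map :: "'a topology \<Rightarrow> 'b topology \<Rightarrow> ('a \<Rightarrow> 'b) \<Rightarrow> bool" where
  "baire_one_map X Y f \<longleftrightarrow>
     f \<in> topspace X \<rightarrow> topspace Y \<and>
     (\<exists>F :: nat \<Rightarrow> 'a \<Rightarrow> 'b.
        (\<forall>n. continuous_map X Y (F n)) \<and>
        (\<forall>x \<in> topspace X. limitin Y (\<lambda>n. F n x) (f x) sequentially))"

text \<open>
  Maps between the carriers are represented by total functions whose values outside
  \<open>topspace X\<close> are irrelevant.  In particular the maps \<open>F n\<close> below are unconstrained
  there, since \<open>homotopic_with (\<lambda>_. True)\<close> imposes no condition outside the carrier.
\<close>

definition homotopical_baire_one_map :: "'a topology \<Rightarrow> 'b topology \<Rightarrow> ('a \<Rightarrow> 'b) \<Rightarrow> bool" where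
  "homotopical_baire_one_map X Y f \<longleftrightarrow>
     f \<in> topspace X \<rightarrow> topspace Y \<and>
     (\<exists>F :: nat \<Rightarrow> 'a \<Rightarrow> 'b.
        (\<forall>n. continuous_map X Y (F n)) \<and>
        (\<forall>m n. homotopic_with (\<lambda>_. True) X Y (F m) (F n)) \<and>
        (\<forall>x \<in> topspace X. limitin Y (\<lambda>n. F n x) (f x) sequentially))"

definition hB\<^sub>1 :: "'a topology \<Rightarrow> 'b topology \<Rightarrow> ('a \<Rightarrow> 'b) set" where
  "hB\<^sub>1 X Y = {f. homotopical_baire_one_map X Y f}"

end

theory Submission
  imports Defs
begin

text \<open>
  Along a homotopy each point traces a path in the target.  In a countable metric space a path
  is constant, because a connected metric space with two points is uncountable.  Hence maps
  into \<open>\<rat>\<close> that are homotopic to one another are equal, and a homotopical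
  Baire-one map into \<open>\<rat>\<close>, being the pointwise limit of a constant sequence, is
  continuous (\<open>hB\<^sub>1_into_countable_continuous\<close>).  It remains to find a
  discontinuous Baire-one function from \<open>\<rat>\<close> to itself; the indicator function of the
  origin is one, since tent functions of height one over shrinking intervals around the origin
  converge to it pointwise and take rational values at rational points
  (\<open>baire_one_indicator_origin\<close>).
\<close>

text \<open>
  The track of \<open>x\<close> under the homotopy is a connected subset of a countable metric space, so
  it cannot contain two points; its end points are \<open>p x\<close> and \<open>q x\<close>.
\<close>

lemma homotopic_into_countable_eq:
  fixes S :: "'b :: metric_space set"
  assumes "countable S"
    and hom: "homotopic_with P X (top_of_set S) p q"
    and x: "x \<in> topspace X"
  shows "p x = q x"
proof -
  obtain h where h: "continuous_map (prod_topology (top_of_set {0..1::real}) X) (top_of_set S) h"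
    and h0: "\<And>x. h (0, x) = p x" and h1: "\<And>x. h (1, x) = q x"
    using hom unfolding homotopic_with_def by auto
  let ?g = "\<lambda>t. h (t, x)"
  have "continuous_map (top_of_set {0..1}) (prod_topology (top_of_set {0..1::real}) X) (\<lambda>t. (t, x))"
    using x by (intro continuous_map_pairedI) auto
  from continuous_map_compose[OF this h]
  have "continuous_map (top_of_set {0..1}) (top_of_set S) ?g"
    by (simp add: o_def)
  then have cont: "continuous_on {0..1} ?g" and sub: "?g ` {0..1} \<subseteq> S"
    by (auto simp: continuous_map_in_subtopology)
  have "connected (?g ` {0..1})"
    using cont by (rule connected_continuous_image) simp
  moreover have "countable (?g ` {0..1})"
    using sub \<open>countable S\<close> by (rule countable_subset)
  ultimately have "?g 0 = ?g 1"
    using connected_uncountable[of "?g ` {0..1}" "?g 0" "?g 1"] by auto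
  then show ?thesis
    by (simp add: h0 h1)
qed

lemma hB\<^sub>1_into_countable_continuous:
  fixes S :: "'b :: metric_space set"
  assumes "countable S" and "f \<in> hB\<^sub>1 X (top_of_set S)"
  shows "continuous_map X (top_of_set S) f"
proof -
  obtain F where F: "\<And>n :: nat. continuous_map X (top_of_set S) (F n)"
    and hom: "\<And>m n. homotopic_with (\<lambda>_. True) X (top_of_set S) (F m) (F n)"
    and lim: "\<And>x. x \<in> topspace X \<Longrightarrow> limitin (top_of_set S) (\<lambda>n. F n x) (f x) sequentially"
    using assms(2) unfolding hB\<^sub>1_def homotopical_baire_one_map_def mem_Collect_eq by blast
  have "F 0 x = f x" if x: "x \<in> topspace X" for x
  proof -
    have const: "(\<lambda>n. F n x) = (\<lambda>n. F 0 x)"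
      by (rule ext) (rule homotopic_into_countable_eq[OF assms(1) hom x])
    from lim[OF x] have "(\<lambda>n. F n x) \<longlonglongrightarrow> f x"
      by (simp add: limitin_subtopology)
    then have "(\<lambda>n :: nat. F 0 x) \<longlonglongrightarrow> f x"
      by (simp only: const)
    then show ?thesis
      by (simp add: LIMSEQ_const_iff)
  qed
  then show ?thesis
    using F[of 0] continuous_map_eq by blast
qed

lemma baire_one_indicator_origin:
  "baire_one_map (top_of_set \<rat>) (top_of_set \<rat>) (indicator {0} :: real \<Rightarrow> real)"
proof -
  define tent :: "nat \<Rightarrow> real \<Rightarrow> real" where "tent n x = max 0 (1 - real n * \<bar>x\<bar>)" for n x
  have ind_rat: "indicator {0} x \<in> (\<rat> :: real set)" for x :: real
    by (simp add: indicator_def)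
  have tent_rat: "tent n x \<in> \<rat>" if "x \<in> \<rat>" for n x
    using that by (auto simp: tent_def max_def)
  have "continuous_map (top_of_set \<rat>) (top_of_set \<rat>) (tent n)" for n
  proof -
    have "continuous_on \<rat> (tent n)"
      unfolding tent_def by (intro continuous_intros)
    then show ?thesis
      using tent_rat by (auto simp: continuous_map_in_subtopology)
  qed
  moreover have "limitin (top_of_set \<rat>) (\<lambda>n. tent n x) (indicator {0} x) sequentially"
    if x: "x \<in> \<rat>" for x
  proof (rule limitin_eventually)
    show "indicator {0} x \<in> topspace (top_of_set (\<rat> :: real set))"
      using ind_rat by simp
    show "\<forall>\<^sub>F n in sequentially. tent n x = indicator {0} x"
    proof (cases "x = 0")
      case True
      then show ?thesis by (simp add: tent_def)
    next
      case False
      \<comment> \<open>From index \<open>N\<close> on, the support of the tent no longer contains \<open>x\<close>.\<close>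
      obtain N :: nat where N: "1 < real N * \<bar>x\<bar>"
        using reals_Archimedean3[of "\<bar>x\<bar>"] False by auto
      have "tent n x = 0" if "n \<ge> N" for n
        using mult_right_mono[of "real N" "real n" "\<bar>x\<bar>"] N that by (simp add: tent_def)
      with False show ?thesis
        by (auto simp: eventually_sequentially)
    qed
  qed
  ultimately show ?thesis
    unfolding baire_one_map_def using ind_rat by auto
qed

text \<open>
  The rational sequence \<open>1 / (n + 1)\<close> tends to the origin while the indicator stays zero along it.
\<close>

lemma indicator_origin_not_continuous_on_Rats:
  "\<not> continuous_on \<rat> (indicator {0} :: real \<Rightarrow> real)"
proof
  assume "continuous_on \<rat> (indicator {0} :: real \<Rightarrow> real)"
  moreover have "(\<lambda>n. inverse (real (Suc n))) \<longlonglongrightarrow> 0"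
    by (rule LIMSEQ_inverse_real_of_nat)
  ultimately have "(\<lambda>n. indicator {0} (inverse (real (Suc n))) :: real) \<longlonglongrightarrow> indicator {0} (0 :: real)"
    by (rule continuous_on_tendsto_compose) (auto intro!: always_eventually simp del: of_nat_Suc)
  then show False
    by (simp add: indicator_def LIMSEQ_const_iff del: of_nat_Suc)
qed

theorem proposition1p5:
  shows "\<exists>f :: real \<Rightarrow> real.
           baire_one_map (top_of_set \<rat>) (top_of_set \<rat>) f \<and>
           f \<notin> hB\<^sub>1 (top_of_set \<rat>) (top_of_set \<rat>)"
proof (intro exI conjI notI)
  show "baire_one_map (top_of_set \<rat>) (top_of_set \<rat>) (indicator {0} :: real \<Rightarrow> real)"
    by (rule baire_one_indicator_origin)
  assume "(indicator {0} :: real \<Rightarrow> real) \<in> hB\<^sub>1 (top_of_set \<rat>) (top_of_set \<rat>)"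
  then have "continuous_map (top_of_set \<rat>) (top_of_set \<rat>) (indicator {0} :: real \<Rightarrow> real)"
    by (rule hB\<^sub>1_into_countable_continuous[OF countable_rat])
  then show False
    using indicator_origin_not_continuous_on_Rats by (simp add: continuous_map_in_subtopology)
qed

end
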